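(* For integers $n\ge 0$ let $$a_n = 2^n\sum_{k=0}^n\frac{k!}{2^{k}},$$ and let $f(x)=\sum_{n\ge 0}a_n\frac{x^n}{n!}$ be the exponential generating function of the sequence $(a_n)_{n\ge 0}$. Then, for real $x$ with $|x|<1$, $$f(x)=2e^{2x-2}\left(\int_0^1\frac{e^{2t}-e^{2(1-x)t}}{t}\,dt-\ln(1-x)\right)+\frac{1}{1-x}.$$ *)

theory Defs
  imports "HOL-Analysis.Analysis"
begin

definition a_seq :: "nat \<Rightarrow> real" where
  "a_seq n = 2 ^ n * (\<Sum>k=0..n. fact k / 2 ^ k)"

(* The sum of the exponential generating series at a point; meaningful only where it converges. *)
definition egf :: "(nat \<Rightarrow> real) \<Rightarrow> real \<Rightarrow> real" where
  "egf c x = (\<Sum>n. c n * x ^ n / fact n)"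

end

theory Submission
  imports Defs
begin

text \<open>
  Both sides solve the initial value problem \<open>y' = 2 y + 1 / (1 - x)\<^sup>2\<close>, \<open>y 0 = 1\<close> on \<open>(-1, 1)\<close>.
  For the generating function this is the recurrence \<open>a (n + 1) = 2 a n + (n + 1)!\<close>. For the
  closed form, the integral equals \<open>E 2 - E (2 (1 - x))\<close> for the entire function
  \<open>E z = (\<Sum>n\<ge>1. z ^ n / (n n!))\<close>, which satisfies \<open>z E' z = exp z - 1\<close>; this makes
  differentiation under the integral sign unnecessary.
\<close>

lemma a_seq_Suc: "a_seq (Suc n) = 2 * a_seq n + fact (Suc n)"
  by (simp add: a_seq_def field_simps)

lemma a_seq_nonneg: "0 \<le> a_seq n"
  by (simp add: a_seq_def sum_nonneg)

lemma a_seq_over_fact_Suc: "a_seq (Suc n) / fact (Suc n) = 2 / Suc n * (a_seq n / fact n) + 1"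
  by (simp add: a_seq_Suc add_divide_distrib del: of_nat_Suc)

text \<open>The ratios start 1, 3, 4, and 4 is their maximum. From \<open>n = 2\<close> on the
  factor \<open>2 / Suc n\<close> is at most 2/3, and 2/3 * 4 + 1 < 4; the first two steps, where
  the factor is 2 or 1, are computed directly.\<close>

lemma a_seq_over_fact_le: "a_seq n / fact n \<le> 4"
proof (induction n)
  case 0
  show ?case by (simp add: a_seq_def)
next
  case (Suc n)
  consider "n = 0" | "n = 1" | "n \<ge> 2" by linarith
  then show ?case
  proof cases
    case 3
    have "2 / Suc n * (a_seq n / fact n) \<le> 2 / 3 * 4"
      using 3 Suc.IH a_seq_nonneg[of n] by (intro mult_mono) (auto simp: field_simps)
    then show ?thesis
      unfolding a_seq_over_fact_Suc by linarith
  qed (simp_all add: a_seq_def)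
qed

lemma summable_a_seq_egf:
  fixes x :: real
  assumes "\<bar>x\<bar> < 1"
  shows "summable (\<lambda>n. a_seq n / fact n * x ^ n)"
proof (rule summable_comparison_test')
  show "summable (\<lambda>n. 4 * \<bar>x\<bar> ^ n)"
    using assms by (intro summable_mult summable_geometric) simp
  show "norm (a_seq n / fact n * x ^ n) \<le> 4 * \<bar>x\<bar> ^ n" if "n \<ge> 0" for n
    using a_seq_over_fact_le[of n] a_seq_nonneg[of n]
    by (simp only: real_norm_def abs_mult power_abs) (intro mult_right_mono; simp)
qed

lemma egf_a_seq_has_derivative:
  fixes x :: real
  assumes "\<bar>x\<bar> < 1"
  shows "(egf a_seq has_real_derivative (2 * egf a_seq x + 1 / (1 - x)\<^sup>2)) (at x)"
proof -
  define c where "c n = a_seq n / fact n" for n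
  have egf_eq: "egf a_seq = (\<lambda>x. \<Sum>n. c n * x ^ n)"
    by (simp add: egf_def c_def fun_eq_iff)
  \<comment> \<open>Termwise differentiation at \<open>x\<close> asks for convergence at a point of
    larger absolute value.\<close>
  obtain K where K: "\<bar>x\<bar> < K" "K < 1"
    using assms dense by blast
  \<comment> \<open>The factor \<open>Suc n\<close> of the derivative clears the denominator in
    \<open>a_seq_over_fact_Suc\<close>; the second summand is the differentiated geometric
    series.\<close>
  have diffs: "diffs c n * x ^ n = 2 * (c n * x ^ n) + of_nat (Suc n) * x ^ n" for n
    by (simp add: diffs_def c_def a_seq_over_fact_Suc algebra_simps del: of_nat_Suc fact_Suc)
  have "(\<lambda>n. diffs c n * x ^ n) sums (2 * egf a_seq x + 1 / (1 - x)\<^sup>2)"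
    unfolding diffs egf_eq c_def using assms
    by (intro sums_add sums_mult summable_sums summable_a_seq_egf geometric_deriv_sums) auto
  moreover have "((\<lambda>x. \<Sum>n. c n * x ^ n) has_real_derivative (\<Sum>n. diffs c n * x ^ n)) (at x)"
    using K summable_a_seq_egf[of K] by (intro termdiffs_strong[of _ K]) (auto simp: c_def)
  ultimately show ?thesis
    by (simp add: egf_eq sums_iff)
qed

text \<open>
  The entire exponential integral. At \<open>n = 0\<close> the coefficient is \<open>1 / 0 = 0\<close>.
\<close>
definition Ein :: "real \<Rightarrow> real" where
  "Ein z = (\<Sum>n. 1 / (of_nat n * fact n) * z ^ n)"

text \<open>The product form also covers \<open>z = 0\<close>, where the quotient
  \<open>(exp z - 1) / z\<close> takes the default value 0 but the derivative is 1.
  Differentiability at 0 is what makes \<open>Ein\<close> continuous there.\<close>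

lemma Ein_has_derivative:
  "\<exists>D. (Ein has_real_derivative D) (at z) \<and> z * D = exp z - 1"
proof -
  define c :: "nat \<Rightarrow> real" where "c n = 1 / (of_nat n * fact n)" for n
  have summ: "summable (\<lambda>n. c n * y ^ n)" for y :: real
  proof (rule summable_comparison_test')
    show "summable (\<lambda>n. inverse (fact n) * \<bar>y\<bar> ^ n)"
      by (rule summable_exp)
    show "norm (c n * y ^ n) \<le> inverse (fact n) * \<bar>y\<bar> ^ n" if "n \<ge> 0" for n
    proof (cases n)
      case (Suc m)
      then have "fact n \<le> real n * fact n" by simp
      then show ?thesis
        by (simp add: c_def abs_mult power_abs divide_inverse mult_right_mono le_imp_inverse_le
            del: inverse_mult_distrib)
    qed (simp add: c_def)
  qed
  \<comment> \<open>Differentiation cancels the extra factor \<open>Suc n\<close> in the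
    denominator, leaving the exponential series without its constant term.\<close>
  have "z * (diffs c n * z ^ n) = z ^ Suc n /\<^sub>R fact (Suc n)" for n
    by (simp add: diffs_def c_def divide_inverse del: of_nat_Suc fact_Suc)
  moreover have "(\<lambda>n. z ^ Suc n /\<^sub>R fact (Suc n)) sums (exp z - 1)"
    using exp_converges[of z] by (subst sums_Suc_iff) simp
  ultimately have "(\<lambda>n. z * (diffs c n * z ^ n)) sums (exp z - 1)"
    by presburger
  moreover have "summable (\<lambda>n. diffs c n * z ^ n)"
    by (rule termdiff_converges_all) (rule summ)
  ultimately have "z * (\<Sum>n. diffs c n * z ^ n) = exp z - 1"
    by (metis sums_unique suminf_mult)
  moreover have "(Ein has_real_derivative (\<Sum>n. diffs c n * z ^ n)) (at z)"
    unfolding Ein_def[abs_def] c_def[symmetric]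
    by (rule termdiffs_strong_converges_everywhere) (rule summ)
  ultimately show ?thesis by blast
qed

lemma Ein_has_derivative':
  assumes "z \<noteq> 0"
  shows "(Ein has_real_derivative ((exp z - 1) / z)) (at z)"
  using Ein_has_derivative[of z] assms by (metis nonzero_mult_div_cancel_left)

lemma Ein_scaled_has_derivative:
  assumes "t \<noteq> 0"
  shows "((\<lambda>t. Ein (c * t)) has_real_derivative ((exp (c * t) - 1) / t)) (at t)"
proof (cases "c = 0")
  case False
  then show ?thesis
    using DERIV_chain2[OF Ein_has_derivative' DERIV_cmult_Id, of c t] assms
    by simp
qed simp

lemma continuous_on_Ein_scaled: "continuous_on A (\<lambda>t. Ein (c * t))"
proof -
  have "continuous_on UNIV Ein"
    by (meson DERIV_isCont Ein_has_derivative continuous_at_imp_continuous_on)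
  then show ?thesis
    by (rule continuous_on_compose2) (auto intro!: continuous_intros)
qed

lemma exp_quotient_has_integral:
  "((\<lambda>t. (exp (a * t) - exp (b * t)) / t) has_integral (Ein a - Ein b)) {0..1}"
proof -
  have "((\<lambda>t. (exp (a * t) - exp (b * t)) / t) has_integral
      (Ein (a * 1) - Ein (b * 1)) - (Ein (a * 0) - Ein (b * 0))) {0..1}"
  \<comment> \<open>At \<open>t = 0\<close> the integrand is 0 by the convention for division, while
    the antiderivative has slope \<open>a - b\<close>. So derivatives are taken in the interior
    only, with continuity at the endpoints.\<close>
  proof (rule fundamental_theorem_of_calculus_interior)
    fix t :: real
    assume "t \<in> {0<..<1}"
    then have "((\<lambda>t. Ein (a * t) - Ein (b * t)) has_real_derivative
        ((exp (a * t) - 1) / t - (exp (b * t) - 1) / t)) (at t)"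
      by (intro DERIV_diff Ein_scaled_has_derivative) auto
    then show "((\<lambda>t. Ein (a * t) - Ein (b * t)) has_vector_derivative
        (exp (a * t) - exp (b * t)) / t) (at t)"
      by (simp add: has_real_derivative_iff_has_vector_derivative flip: diff_divide_distrib)
  qed (auto intro!: continuous_on_diff continuous_on_Ein_scaled)
  then show ?thesis by simp
qed

definition closed_form :: "real \<Rightarrow> real" where
  "closed_form x =
    2 * exp (2 * x - 2) * (Ein 2 - Ein (2 * (1 - x)) - ln (1 - x)) + 1 / (1 - x)"

lemma closed_form_has_derivative:
  assumes "x < 1"
  shows "(closed_form has_real_derivative (2 * closed_form x + 1 / (1 - x)\<^sup>2)) (at x)"
proof -
  have Ein': "((\<lambda>x. Ein (2 * (1 - x))) has_real_derivative
      ((exp (2 * (1 - x)) - 1) / (2 * (1 - x)) * (- 2))) (at x)"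
    using assms
    by (intro DERIV_chain2[OF Ein_has_derivative']) (auto intro!: derivative_eq_intros)
  have ln': "((\<lambda>x. ln (1 - x)) has_real_derivative - 1 / (1 - x)) (at x)"
    using assms by (auto intro!: derivative_eq_intros)
  \<comment> \<open>With \<open>E = exp (2 * (1 - x))\<close> and \<open>u = 1 - x\<close>: the
    logarithm contributes \<open>1 / u\<close>, which cancels the -1 in the derivative of
    \<open>Ein\<close>.\<close>
  have "0 - (E - 1) / (2 * u) * (- 2) - (- 1 / u) = E / u" for E u :: real
    by (simp add: diff_divide_distrib)
  then have "((\<lambda>x. Ein 2 - Ein (2 * (1 - x)) - ln (1 - x)) has_real_derivative
      exp (2 * (1 - x)) / (1 - x)) (at x)"
    using DERIV_diff[OF DERIV_diff[OF DERIV_const Ein'] ln'] by metis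
  moreover have "((\<lambda>x. 2 * exp (2 * x - 2)) has_real_derivative 4 * exp (2 * x - 2)) (at x)"
    by (auto intro!: derivative_eq_intros)
  moreover have "((\<lambda>x. 1 / (1 - x)) has_real_derivative 1 / (1 - x)\<^sup>2) (at x)"
    using assms by (auto intro!: derivative_eq_intros simp: power2_eq_square)
  ultimately have "(closed_form has_real_derivative
      4 * exp (2 * x - 2) * (Ein 2 - Ein (2 * (1 - x)) - ln (1 - x))
      + exp (2 * (1 - x)) / (1 - x) * (2 * exp (2 * x - 2))
      + 1 / (1 - x)\<^sup>2) (at x)"
    unfolding closed_form_def[abs_def] by (intro DERIV_add DERIV_mult)
  \<comment> \<open>The exponents cancel. The result is twice the last summand of
    \<open>closed_form x\<close>, which completes the term \<open>2 * closed_form x\<close>.\<close>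
  moreover have "exp (2 * (1 - x)) / (1 - x) * (2 * exp (2 * x - 2)) = 2 / (1 - x)"
    by (simp flip: exp_add)
  ultimately show ?thesis
    by (elim DERIV_cong) (simp only: closed_form_def, simp)
qed

text \<open>The difference of two solutions solves the homogeneous equation, so the integrating
  factor \<open>exp (- c * t)\<close> turns it into a constant, which vanishes at
  \<open>x\<close>.\<close>

lemma linear_ode_unique:
  fixes f g r :: "real \<Rightarrow> real"
  assumes S: "convex S" and xy: "x \<in> S" "y \<in> S" and eq: "f x = g x"
    and f: "\<And>t. t \<in> S \<Longrightarrow> (f has_real_derivative c * f t + r t) (at t within S)"
    and g: "\<And>t. t \<in> S \<Longrightarrow> (g has_real_derivative c * g t + r t) (at t within S)"
  shows "f y = g y"
proof -
  let ?h = "\<lambda>t. exp (- c * t) * (f t - g t)"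
  have "(?h has_real_derivative 0) (at t within S)" if "t \<in> S" for t
    using f[OF that] g[OF that]
    by (auto intro!: derivative_eq_intros simp: algebra_simps)
  then obtain k where "\<And>t. t \<in> S \<Longrightarrow> ?h t = k"
    using has_field_derivative_zero_constant[OF S, of ?h] by blast
  then have "?h y = ?h x" using xy by presburger
  then show ?thesis using eq by simp
qed

lemma egf_a_seq_eq_closed_form:
  assumes "\<bar>x\<bar> < 1"
  shows "egf a_seq x = closed_form x"
proof (rule linear_ode_unique[where f = "egf a_seq" and g = closed_form and c = 2
      and r = "\<lambda>t. 1 / (1 - t)\<^sup>2" and S = "{-1<..<1}" and x = 0])
  show "convex {-1<..<1::real}" by simp
  \<comment> \<open>Both values are 1: the series reduces to \<open>a_seq 0\<close>, and the bracket
    in \<open>closed_form\<close> vanishes.\<close>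
  show "egf a_seq 0 = closed_form 0"
    using powser_zero[of "\<lambda>n. a_seq n / fact n"]
    by (simp add: egf_def closed_form_def a_seq_def)
  fix t :: real
  assume "t \<in> {-1<..<1}"
  then have "\<bar>t\<bar> < 1" by auto
  then show "(egf a_seq has_real_derivative 2 * egf a_seq t + 1 / (1 - t)\<^sup>2) (at t within {-1<..<1})"
    and "(closed_form has_real_derivative 2 * closed_form t + 1 / (1 - t)\<^sup>2) (at t within {-1<..<1})"
    by (auto intro!: DERIV_subset[OF egf_a_seq_has_derivative]
        DERIV_subset[OF closed_form_has_derivative])
qed (use assms in auto)

theorem theorem14:
  fixes x :: real
  assumes "\<bar>x\<bar> < 1"
  shows "summable (\<lambda>n. a_seq n * x ^ n / fact n)
      \<and> (\<lambda>t::real. (exp (2 * t) - exp (2 * (1 - x) * t)) / t) integrable_on {0..1}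
      \<and> egf a_seq x =
      2 * exp (2 * x - 2) *
        (integral {0..1} (\<lambda>t::real. (exp (2 * t) - exp (2 * (1 - x) * t)) / t) - ln (1 - x))
      + 1 / (1 - x)"
proof (intro conjI)
  note int = exp_quotient_has_integral[of 2 "2 * (1 - x)"]
  show "summable (\<lambda>n. a_seq n * x ^ n / fact n)"
    using summable_a_seq_egf[OF assms] by simp
  show "(\<lambda>t::real. (exp (2 * t) - exp (2 * (1 - x) * t)) / t) integrable_on {0..1}"
    using int by (rule has_integral_integrable)
  show "egf a_seq x = 2 * exp (2 * x - 2) *
      (integral {0..1} (\<lambda>t::real. (exp (2 * t) - exp (2 * (1 - x) * t)) / t) - ln (1 - x))
      + 1 / (1 - x)"
    unfolding integral_unique[OF int] egf_a_seq_eq_closed_form[OF assms] closed_form_def ..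
qed

end
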